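(* For every $n\ge2$, in continuous $n$-player Guts the profile in which every player uses in every round the pure threshold strategy $p_\circ=(1/2)^{1/(n-1)}$ is a symmetric Nash equilibrium with total expected return zero for every player: if players $2,\dots,n$ all use $p_\circ$ in every round, then no strategy sequence of player 1 (and, by symmetry, likewise for any other player) has positive total expected return. This equilibrium is nonstrict: a single player can deviate from it to another strategy without decreasing that player's total expected return. For $n\ge3$ it is not a strong Nash equilibrium: with player 1 continuing to use $p_\circ$ in every round, players $2,\dots,n$ can deviate jointly so that their joint total expected return is strictly positive and the return of player 1 is strictly negative.
   Context: Continuous $n$-player Guts: players $1,\dots,n$ receive independent hands $p_1,\dots,p_n$ uniform on $[0,1]$. A pure strategy of player $i$ is a threshold $p_i^*\in[0,1]$: hold if $p_i\ge p_i^*$, drop if $p_i<p_i^*$. Each ante is one unit, so the pot is $n$. Let $r$ be the number of holding players. If $r=0$, the immediate return to each player is $0$ and the game is replayed with stakes factor $1$. If $r\ge1$, the stakes factor for the replay is $r-1$ (factor $0$ means the game ends) and a player's immediate return is $(r-2)+n$ if the player holds and has the highest hand among holders, $(r-2)-n$ if the player holds but does not have the highest hand, and $r-2$ if the player drops. The immediate returns sum to zero over all players. $\alpha(p_1^*,\dots,p_n^* )$ is the expected immediate return to player 1, $\beta(p_1^*,\dots,p_n^* )$ the expected stakes factor, extended by averaging to mixed strategies (probability measures on thresholds; for a coalition, probability measures on joint thresholds). If a strategy sequence of each player (or coalition) is fixed, with expected immediate returns $\alpha_k$ of a given player and expected stakes factors $\beta_k$ in round $k$, the total expected return of that player is $\sum_{k\ge1}\big(\prod_{i<k}\beta_i\big)\alpha_k$,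 when this series converges. A Nash equilibrium is a profile from which no single player can improve their return by deviating alone; it is strict if every unilateral deviation strictly lowers the deviating player's return; it is strong if no subset of players can improve their joint return (sum of returns) by jointly deviating. *)

theory Defs
  imports "HOL-Probability.Probability"
begin

text \<open>
  Players are the naturals in \<open>{1..n}\<close>; hands and thresholds are functions from players to reals.
\<close>

definition hands :: "nat \<Rightarrow> (nat \<Rightarrow> real) measure" where
  "hands n = PiM {1..n} (\<lambda>_. uniform_measure lborel {0..1})"

definition holders :: "nat \<Rightarrow> (nat \<Rightarrow> real) \<Rightarrow> (nat \<Rightarrow> real) \<Rightarrow> nat set" where
  "holders n t p = {i \<in> {1..n}. t i \<le> p i}"

text \<open>
  If several holders tie for the highest hand, each of them is counted as a winner. Ties have
  probability zero, so this choice does not affect expectations.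
\<close>

definition immediate_return ::
    "nat \<Rightarrow> (nat \<Rightarrow> real) \<Rightarrow> (nat \<Rightarrow> real) \<Rightarrow> nat \<Rightarrow> real" where
  "immediate_return n t p i =
    (let H = holders n t p; r = real (card H) in
      if H = {} then 0
      else if i \<in> H \<and> (\<forall>j\<in>H. p j \<le> p i) then (r - 2) + real n
      else if i \<in> H then (r - 2) - real n
      else r - 2)"

definition stakes_factor :: "nat \<Rightarrow> (nat \<Rightarrow> real) \<Rightarrow> (nat \<Rightarrow> real) \<Rightarrow> real" where
  "stakes_factor n t p =
    (let H = holders n t p in if H = {} then 1 else real (card H) - 1)"

definition alpha :: "nat \<Rightarrow> nat \<Rightarrow> (nat \<Rightarrow> real) \<Rightarrow> real" where
  "alpha n i t = (\<integral>p. immediate_return n t p i \<partial>hands n)"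

definition beta :: "nat \<Rightarrow> (nat \<Rightarrow> real) \<Rightarrow> real" where
  "beta n t = (\<integral>p. stakes_factor n t p \<partial>hands n)"

text \<open>
  Mixed strategies are Borel probability measures on the reals that are concentrated on \<open>{0..1}\<close>;
  a joint mixed strategy of a coalition \<open>C\<close> is a (possibly correlated) probability measure on
  threshold vectors indexed by \<open>C\<close>.
\<close>

definition mixed_strategy :: "real measure \<Rightarrow> bool" where
  "mixed_strategy \<mu> \<longleftrightarrow>
    prob_space \<mu> \<and> sets \<mu> = sets borel \<and> (AE x in \<mu>. x \<in> {0..1})"

definition joint_strategy :: "nat set \<Rightarrow> (nat \<Rightarrow> real) measure \<Rightarrow> bool" where
  "joint_strategy C \<nu> \<longleftrightarrow>
    prob_space \<nu> \<and> sets \<nu> = sets (PiM C (\<lambda>_. borel)) \<and>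
    (AE t in \<nu>. \<forall>i\<in>C. t i \<in> {0..1})"

definition pure :: "real \<Rightarrow> real measure" where
  "pure q = return borel q"

definition alpha_mixed :: "nat \<Rightarrow> nat \<Rightarrow> (nat \<Rightarrow> real) measure \<Rightarrow> real" where
  "alpha_mixed n i L = (\<integral>t. alpha n i t \<partial>L)"

definition beta_mixed :: "nat \<Rightarrow> (nat \<Rightarrow> real) measure \<Rightarrow> real" where
  "beta_mixed n L = (\<integral>t. beta n t \<partial>L)"

text \<open>
  Rounds are numbered from 0. A strategy sequence gives one mixed strategy per round, and a
  profile \<open>\<sigma>\<close> gives player \<open>i\<close> the strategy \<open>\<sigma> i k\<close> in round \<open>k\<close>. Returns are computed from the joint
  law of all \<open>n\<close> thresholds in each round.
\<close>

definition has_total_return ::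
    "nat \<Rightarrow> (nat \<Rightarrow> (nat \<Rightarrow> real) measure) \<Rightarrow> nat \<Rightarrow> real \<Rightarrow> bool" where
  "has_total_return n L i s \<longleftrightarrow>
    (\<lambda>k. (\<Prod>m<k. beta_mixed n (L m)) * alpha_mixed n i (L k)) sums s"

definition strategy_profile :: "nat \<Rightarrow> (nat \<Rightarrow> nat \<Rightarrow> real measure) \<Rightarrow> bool" where
  "strategy_profile n \<sigma> \<longleftrightarrow> (\<forall>i\<in>{1..n}. \<forall>k. mixed_strategy (\<sigma> i k))"

definition profile_law ::
    "nat \<Rightarrow> (nat \<Rightarrow> nat \<Rightarrow> real measure) \<Rightarrow> nat \<Rightarrow> (nat \<Rightarrow> real) measure" where
  "profile_law n \<sigma> k = PiM {1..n} (\<lambda>i. \<sigma> i k)"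

text \<open>
  The coalition \<open>C\<close> plays \<open>\<nu> k\<close> in round \<open>k\<close>, independently of the remaining players, who follow \<open>\<sigma>\<close>.
\<close>

definition coalition_law ::
    "nat \<Rightarrow> (nat \<Rightarrow> nat \<Rightarrow> real measure) \<Rightarrow> nat set \<Rightarrow> (nat \<Rightarrow> (nat \<Rightarrow> real) measure)
      \<Rightarrow> nat \<Rightarrow> (nat \<Rightarrow> real) measure" where
  "coalition_law n \<sigma> C \<nu> k =
    distr (\<nu> k \<Otimes>\<^sub>M PiM ({1..n} - C) (\<lambda>i. \<sigma> i k)) (PiM {1..n} (\<lambda>_. borel))
      (merge C ({1..n} - C))"

text \<open>
  Returns exist only when the defining series converges, so a deviation is compared with the
  profile when it has a total expected return.
\<close>

definition nash_equilibrium :: "nat \<Rightarrow> (nat \<Rightarrow> nat \<Rightarrow> real measure) \<Rightarrow> bool" where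
  "nash_equilibrium n \<sigma> \<longleftrightarrow>
    strategy_profile n \<sigma> \<and>
    (\<forall>i\<in>{1..n}. \<exists>s. has_total_return n (profile_law n \<sigma>) i s \<and>
      (\<forall>\<tau> s'. (\<forall>k. mixed_strategy (\<tau> k)) \<longrightarrow>
        has_total_return n (profile_law n (\<sigma>(i := \<tau>))) i s' \<longrightarrow> s' \<le> s))"

definition strict_nash_equilibrium :: "nat \<Rightarrow> (nat \<Rightarrow> nat \<Rightarrow> real measure) \<Rightarrow> bool" where
  "strict_nash_equilibrium n \<sigma> \<longleftrightarrow>
    nash_equilibrium n \<sigma> \<and>
    (\<forall>i\<in>{1..n}. \<exists>s. has_total_return n (profile_law n \<sigma>) i s \<and>
      (\<forall>\<tau> s'. (\<forall>k. mixed_strategy (\<tau> k)) \<longrightarrow> \<tau> \<noteq> \<sigma> i \<longrightarrow>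
        has_total_return n (profile_law n (\<sigma>(i := \<tau>))) i s' \<longrightarrow> s' < s))"

definition strong_nash_equilibrium :: "nat \<Rightarrow> (nat \<Rightarrow> nat \<Rightarrow> real measure) \<Rightarrow> bool" where
  "strong_nash_equilibrium n \<sigma> \<longleftrightarrow>
    nash_equilibrium n \<sigma> \<and>
    (\<forall>C \<nu> s s'. C \<subseteq> {1..n} \<longrightarrow> (\<forall>k. joint_strategy C (\<nu> k)) \<longrightarrow>
      (\<forall>i\<in>C. has_total_return n (profile_law n \<sigma>) i (s i)) \<longrightarrow>
      (\<forall>i\<in>C. has_total_return n (coalition_law n \<sigma> C \<nu>) i (s' i)) \<longrightarrow>
      (\<Sum>i\<in>C. s' i) \<le> (\<Sum>i\<in>C. s i))"

definition p_circ :: "nat \<Rightarrow> real" where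
  "p_circ n = (1/2) powr (1 / (real n - 1))"

definition circ_profile :: "nat \<Rightarrow> nat \<Rightarrow> nat \<Rightarrow> real measure" where
  "circ_profile n = (\<lambda>i k. pure (p_circ n))"

end

theory Submission
  imports Defs
begin

text \<open>
  Write \<open>c = p_circ n\<close>, so that \<open>c ^ (n - 1) = 1/2\<close>. For thresholds \<open>t\<close> in the unit interval,

    \<open>beta n t = (\<Sum>j. 1 - t j) - 1 + 2 * (\<Prod>j. t j)\<close>

  (lemma \<open>beta_eq\<close>). The return of player \<open>i\<close> in a round is the stakes factor minus one, plus \<open>n\<close> times
  an even-odds bet on the highest hand that is placed whenever the player holds (lemma \<open>alpha_eq\<close>).

  If all players but \<open>i\<close> use \<open>c\<close>, then \<open>beta\<close> is affine in \<open>t i\<close> with slope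
  \<open>-1 + 2 * c ^ (n - 1) = 0\<close>: one player alone cannot influence the stakes (lemma \<open>beta_deviation\<close>).
  What remains is the bet. A hand below \<open>c\<close> wins exactly if all others drop, that is with probability
  \<open>1/2\<close>, so below \<open>c\<close> the bet is fair, and above \<open>c\<close> it is favourable. Hence the threshold \<open>c\<close> and every
  lower threshold give the best possible one-round return, which is \<open>0\<close>, and the others give at most
  that (\<open>alpha_deviation_bounds\<close>, \<open>alpha_deviation_eq_0\<close>). As \<open>beta\<close> is a constant below \<open>1\<close>, the total
  return is an absolutely convergent series of nonpositive terms (\<open>deviation_total_return\<close>). A player
  who always holds still gets \<open>0\<close>, so the equilibrium is not strict.

  Two players together can influence the stakes: the mixed second derivatives of \<open>beta\<close> are positive at
  the symmetric profile, so moving one threshold up and another one down decreases \<open>beta\<close>. When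
  player 2 raises the threshold by a small \<open>e\<close> and player 3 always holds, the return of player 1 decreases
  by \<open>e\<close> through the stakes and increases by \<open>O(e * e)\<close> through the bet (\<open>alpha_coalition_neg\<close>). The
  returns of all players have a nonnegative sum (\<open>sum_alpha_nonneg\<close>), so the coalition gains jointly.
\<close>

section \<open>Hands and their expectations\<close>

definition unif :: "real measure" where
  "unif = uniform_measure lborel {0..1}"

lemma sets_unif [simp, measurable_cong]: "sets unif = sets borel"
  and space_unif [simp]: "space unif = UNIV"
  by (simp_all add: unif_def)

lemma prob_space_unif: "prob_space unif"
  unfolding unif_def by (rule prob_space_uniform_measure) auto

interpretation unif: prob_space unif by (rule prob_space_unif)

interpretation unifs: product_sigma_finite "\<lambda>_ :: nat. unif" ..

lemma hands_eq: "hands n = PiM {1..n} (\<lambda>_. unif)"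
  by (simp add: hands_def unif_def)

interpretation hands: prob_space "hands n"
  unfolding hands_eq by (rule prob_space_PiM) (rule prob_space_unif)

lemma AE_unif: "AE x in unif. x \<in> {0..1}"
  unfolding unif_def by (rule AE_uniform_measureI) auto

lemma measure_unif:
  assumes "A \<in> sets borel"
  shows "measure unif A = measure lborel ({0..1} \<inter> A)"
  using assms unfolding unif_def by (subst measure_uniform_measure) auto

lemma measure_unif_Ici: "x \<in> {0..1} \<Longrightarrow> measure unif {x..} = 1 - x"
proof -
  assume "x \<in> {0..1}"
  moreover from this have "{0..1} \<inter> {x..} = {x..1}" by auto
  ultimately show ?thesis by (simp add: measure_unif)
qed

lemma measure_unif_Iio: "x \<in> {0..1} \<Longrightarrow> measure unif {..<x} = x"
proof -
  assume "x \<in> {0..1}"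
  moreover from this have "{0..1} \<inter> {..<x} = {0..<x}" by auto
  ultimately show ?thesis by (simp add: measure_unif)
qed

lemma measure_unif_Iio_Iic:
  assumes "t \<in> {0..1}" "x \<in> {0..1}"
  shows "measure unif ({..<t} \<union> {..x}) = max t x"
proof (cases "t \<le> x")
  case True
  hence "{0..1} \<inter> ({..<t} \<union> {..x}) = {0..x}" using assms by auto
  with True assms show ?thesis by (simp add: measure_unif max_def)
next
  case False
  hence "{0..1} \<inter> ({..<t} \<union> {..x}) = {0..<t}" using assms by auto
  with False assms show ?thesis by (simp add: measure_unif max_def)
qed

lemma integral_unif:
  fixes f :: "real \<Rightarrow> real"
  assumes [measurable]: "f \<in> borel_measurable borel"
  shows "integral\<^sup>L unif f = (\<integral>x. f x * indicator {0..1} x \<partial>lborel)"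
proof -
  have "unif = density lborel (\<lambda>x. ennreal (indicator {0..1} x))"
    unfolding unif_def uniform_measure_def
    by (intro density_cong) (auto simp: indicator_def)
  hence "integral\<^sup>L unif f = (\<integral>x. indicator {0..1} x *\<^sub>R f x \<partial>lborel)"
    by (rule ssubst) (rule integral_density, auto)
  thus ?thesis by (simp add: mult.commute)
qed

text \<open>
  Every player's hand is uniform, so an expectation of a function of one hand is a one-dimensional
  integral.
\<close>
lemma hands_component:
  fixes f :: "real \<Rightarrow> real"
  assumes "j \<in> {1..n}" and [measurable]: "f \<in> borel_measurable borel"
  shows "(\<integral>p. f (p j) \<partial>hands n) = integral\<^sup>L unif f"
proof -
  have "integral\<^sup>L unif f = integral\<^sup>L (distr (hands n) unif (\<lambda>p. p j)) f"
    unfolding hands_eq by (subst distr_PiM_component) (use assms prob_space_unif in auto)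
  also have "\<dots> = (\<integral>p. f (p j) \<partial>hands n)"
    by (rule integral_distr) (use assms in \<open>auto simp: hands_eq\<close>)
  finally show ?thesis ..
qed

section \<open>Returns and stakes as sums and products over players\<close>

lemma indicator_Ici: "(indicator {a..} x :: real) = (if a \<le> x then 1 else 0)"
 and indicator_Iio: "(indicator {..<a} x :: real) = (if x < a then 1 else 0)"
 and indicator_Iio_Iic: "(indicator ({..<a} \<union> {..b}) x :: real) = (if x < a \<or> x \<le> b then 1 else 0)"
  by (auto simp: indicator_def)

text \<open>
  With \<open>r\<close> holders the stakes factor is \<open>r - 1\<close>, except that \<open>r = 0\<close> gives \<open>1\<close> instead of \<open>-1\<close>: the
  last summand corrects for this by adding \<open>2\<close> when all players drop.
\<close>
lemma stakes_factor_eq: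
  "stakes_factor n t p =
    (\<Sum>j=1..n. indicator {t j..} (p j)) - 1 + 2 * (\<Prod>j=1..n. indicator {..<t j} (p j))"
proof -
  have "(\<Sum>j=1..n. indicator {t j..} (p j)) = real (card (holders n t p))"
    by (simp add: holders_def indicator_Ici sum.If_cases Int_def)
  moreover have "(\<Prod>j=1..n. indicator {..<t j} (p j)) = (if holders n t p = {} then 1 else 0 :: real)"
  proof (cases "holders n t p = {}")
    case True
    hence "p j < t j" if "j \<in> {1..n}" for j
      using that unfolding holders_def by (metis (mono_tags, lifting) empty_iff mem_Collect_eq not_le)
    thus ?thesis using True by (simp add: indicator_Iio)
  qed (auto simp: holders_def indicator_Iio not_less intro!: prod_zero)
  ultimately show ?thesis by (auto simp: stakes_factor_def Let_def)
qed

text \<open>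
  The event of holding the highest hand is written as a product over the opponents, because the factors
  become independent once the hand of player \<open>i\<close> is fixed.
\<close>
definition win :: "nat \<Rightarrow> (nat \<Rightarrow> real) \<Rightarrow> nat \<Rightarrow> (nat \<Rightarrow> real) \<Rightarrow> real" where
  "win n t i p = indicator {t i..} (p i) *
    (\<Prod>j\<in>{1..n} - {i}. indicator ({..<t j} \<union> {..p i}) (p j))"

text \<open>
  The common part \<open>r - 2\<close> of all returns is the stakes factor minus one, also when nobody holds. On
  top of this a holder bets \<open>n\<close> units at even odds on having the highest hand.
\<close>
lemma immediate_return_eq:
  assumes "i \<in> {1..n}"
  shows "immediate_return n t p i =
    stakes_factor n t p - 1 + real n * (2 * win n t i p - indicator {t i..} (p i))"
proof -
  have "win n t i p = (if i \<in> holders n t p \<and> (\<forall>j\<in>holders n t p. p j \<le> p i) then 1 else 0)"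
  proof (cases "i \<in> holders n t p \<and> (\<forall>j\<in>holders n t p. p j \<le> p i)")
    case True
    thus ?thesis
      unfolding win_def by (subst prod.neutral) (auto simp: holders_def indicator_Iio_Iic not_less)
  next
    case False
    show ?thesis
    proof (cases "t i \<le> p i")
      case True
      with False assms obtain j where "j \<in> {1..n}" "t j \<le> p j" "p i < p j"
        by (auto simp: holders_def not_le)
      hence "j \<in> {1..n} - {i}" "p j \<notin> {..<t j} \<union> {..p i}" by auto
      hence "(\<Prod>j\<in>{1..n} - {i}. indicator ({..<t j} \<union> {..p i}) (p j)) = (0::real)"
        by (intro prod_zero) (auto simp: indicator_Iio_Iic not_less not_le)
      with False show ?thesis by (simp only: win_def) simp
    qed (use False in \<open>auto simp: win_def\<close>)
  qed
  moreover have "indicator {t i..} (p i) = (if i \<in> holders n t p then 1 else 0 :: real)"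
    using assms by (auto simp: holders_def)
  ultimately show ?thesis
    by (auto simp: immediate_return_def stakes_factor_def Let_def)
qed

text \<open>
  Joint measurability in thresholds and hands makes \<open>alpha\<close> and \<open>beta\<close> measurable in the thresholds,
  so that their averages over mixed strategies may be computed from their values almost everywhere.
\<close>
lemma measurable_component_pair:
  assumes "j \<in> {1..n}"
  shows "(\<lambda>z. fst z j) \<in> borel_measurable (PiM {1..n} (\<lambda>_. borel :: real measure) \<Otimes>\<^sub>M hands n)"
    and "(\<lambda>z. snd z j) \<in> borel_measurable (PiM {1..n} (\<lambda>_. borel :: real measure) \<Otimes>\<^sub>M hands n)"
  using assms unfolding hands_eq
  by (auto intro!: measurable_compose[OF measurable_fst] measurable_compose[OF measurable_snd]
        measurable_component_singleton[where M="\<lambda>_. borel", THEN measurable_compose]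
        measurable_component_singleton[where M="\<lambda>_. unif", THEN measurable_compose])

lemma measurable_stakes_factor:
  "(\<lambda>(t, p). stakes_factor n t p) \<in> borel_measurable (PiM {1..n} (\<lambda>_. borel) \<Otimes>\<^sub>M hands n)"
  unfolding stakes_factor_eq indicator_Ici indicator_Iio split_beta
  by (intro borel_measurable_add borel_measurable_diff borel_measurable_times borel_measurable_sum
     borel_measurable_prod borel_measurable_const measurable_If borel_measurable_le borel_measurable_less
     measurable_component_pair)

lemma measurable_win:
  assumes i: "i \<in> {1..n}"
  shows "(\<lambda>(t, p). win n t i p) \<in> borel_measurable (PiM {1..n} (\<lambda>_. borel) \<Otimes>\<^sub>M hands n)"
proof -
  let ?M = "PiM {1..n} (\<lambda>_. borel) \<Otimes>\<^sub>M hands n"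
  have "{z \<in> space ?M. snd z j < fst z j \<or> snd z j \<le> snd z i} \<in> sets ?M" if j: "j \<in> {1..n} - {i}" for j
  proof -
    have "j \<in> {1..n}" using j by simp
    note [measurable] = measurable_component_pair[OF i] measurable_component_pair[OF this]
    show ?thesis by measurable
  qed
  thus ?thesis
    unfolding win_def indicator_Ici indicator_Iio_Iic split_beta
    by (intro borel_measurable_times borel_measurable_prod borel_measurable_const measurable_If
      borel_measurable_le measurable_component_pair i)
qed

lemma measurable_immediate_return:
  assumes "i \<in> {1..n}"
  shows "(\<lambda>(t, p). immediate_return n t p i) \<in> borel_measurable (PiM {1..n} (\<lambda>_. borel) \<Otimes>\<^sub>M hands n)"
  using measurable_stakes_factor[of n] measurable_win[OF assms] assms
  unfolding immediate_return_eq[OF assms] indicator_Ici split_beta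
  by (intro borel_measurable_add borel_measurable_diff borel_measurable_times
     borel_measurable_const measurable_If borel_measurable_le measurable_component_pair)

lemma measurable_alpha:
  "i \<in> {1..n} \<Longrightarrow> alpha n i \<in> borel_measurable (PiM {1..n} (\<lambda>_. borel))"
  unfolding alpha_def[abs_def]
  by (rule hands.borel_measurable_lebesgue_integral) (rule measurable_immediate_return)

lemma measurable_beta: "beta n \<in> borel_measurable (PiM {1..n} (\<lambda>_. borel))"
  unfolding beta_def[abs_def]
  by (rule hands.borel_measurable_lebesgue_integral) (rule measurable_stakes_factor)


lemma win_eq_01: "win n t i p \<in> {0..1}"
  unfolding win_def by (auto intro!: mult_nonneg_nonneg mult_le_one prod_nonneg prod_le_1)

lemma integrable_win:
  assumes i: "i \<in> {1..n}"
  shows "integrable (hands n) (win n t i)"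
proof -
  let ?t = "restrict t {1..n}"
  have "win n ?t i p = win n t i p" for p
    unfolding win_def using i by (intro arg_cong2[of _ _ _ _ "(*)"] prod.cong) auto
  moreover have "?t \<in> space (PiM {1..n} (\<lambda>_. borel))" by (auto simp: space_PiM)
  ultimately have "win n t i \<in> borel_measurable (hands n)"
    using measurable_Pair2[OF measurable_win[OF i], of ?t] by simp
  thus ?thesis
    by (intro hands.integrable_const_bound[of _ 1]) (use win_eq_01[of n t i] in auto)
qed

lemma expectation_holds:
  assumes "t \<in> {0..1}" "i \<in> {1..n}"
  shows "(\<integral>p. indicator {t..} (p i) \<partial>hands n) = 1 - t"
  using assms by (subst hands_component) (auto simp: measure_unif_Ici)

lemma integrable_hands_indicator:
  assumes "i \<in> {1..n}" "A \<in> sets borel"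
  shows "integrable (hands n) (\<lambda>p. indicator A (p i) :: real)"
proof -
  have "(\<lambda>p. p i) \<in> hands n \<rightarrow>\<^sub>M borel"
    using assms unfolding hands_eq by measurable
  moreover have "(indicator A :: real \<Rightarrow> real) \<in> borel_measurable borel" using assms by simp
  ultimately have "(\<lambda>p. indicator A (p i) :: real) \<in> borel_measurable (hands n)"
    by (rule measurable_compose)
  thus ?thesis by (intro hands.integrable_const_bound[of _ 1]) auto
qed

lemma integrable_indicator_unif:
  "A \<in> sets borel \<Longrightarrow> integrable unif (indicator A :: real \<Rightarrow> real)"
  by (rule integrable_real_indicator) (auto simp: unif.emeasure_finite less_top[symmetric])

lemma integrable_none_holds:
  "integrable (hands n) (\<lambda>p. \<Prod>j=1..n. indicator {..<t j} (p j) :: real)"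
  unfolding hands_eq
  by (rule unifs.product_integrable_prod) (auto intro: integrable_indicator_unif)

lemma integrable_stakes_factor: "integrable (hands n) (stakes_factor n t)"
  unfolding stakes_factor_eq[abs_def]
  by (intro Bochner_Integration.integrable_add Bochner_Integration.integrable_diff
        Bochner_Integration.integrable_sum integrable_mult_right integrable_hands_indicator
        integrable_none_holds) auto

lemma beta_eq:
  assumes t: "\<And>j. j \<in> {1..n} \<Longrightarrow> t j \<in> {0..1}"
  shows "beta n t = (\<Sum>j=1..n. 1 - t j) - 1 + 2 * (\<Prod>j=1..n. t j)"
proof -
  have "(\<integral>p. (\<Prod>j=1..n. indicator {..<t j} (p j)) \<partial>hands n) =
      (\<Prod>j=1..n. integral\<^sup>L unif (indicator {..<t j}) :: real)"
    unfolding hands_eq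
    by (rule unifs.product_integral_prod) (auto intro: integrable_indicator_unif)
  also have "\<dots> = (\<Prod>j=1..n. t j)"
    by (rule prod.cong) (use t in \<open>auto simp: measure_unif_Iio\<close>)
  finally have prod: "(\<integral>p. (\<Prod>j=1..n. indicator {..<t j} (p j)) \<partial>hands n) = (\<Prod>j=1..n. t j)" .
  have "beta n t = (\<integral>p. (\<Sum>j=1..n. indicator {t j..} (p j)) - 1 \<partial>hands n)
      + (\<integral>p. 2 * (\<Prod>j=1..n. indicator {..<t j} (p j)) \<partial>hands n)"
    unfolding beta_def stakes_factor_eq
    by (intro Bochner_Integration.integral_add Bochner_Integration.integrable_diff
        Bochner_Integration.integrable_sum integrable_mult_right integrable_hands_indicator
        integrable_none_holds) auto
  also have "(\<integral>p. (\<Sum>j=1..n. indicator {t j..} (p j)) - 1 \<partial>hands n) =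
      (\<Sum>j=1..n. \<integral>p. indicator {t j..} (p j) \<partial>hands n) - (1::real)"
    by (subst Bochner_Integration.integral_diff)
       (auto simp: Bochner_Integration.integral_sum hands.prob_space integrable_hands_indicator)
  also have "(\<Sum>j=1..n. \<integral>p. indicator {t j..} (p j) \<partial>hands n) = (\<Sum>j=1..n. 1 - t j)"
    by (rule sum.cong) (use t expectation_holds in auto)
  also have "(\<integral>p. 2 * (\<Prod>j=1..n. indicator {..<t j} (p j)) \<partial>hands n) = 2 * (\<Prod>j=1..n. t j)"
    unfolding prod[symmetric] by simp
  finally show ?thesis .
qed

text \<open>
  Conditionally on \<open>p i = x\<close>, the others fail to beat player \<open>i\<close> independently of each other, and
  player \<open>j\<close> fails exactly when \<open>p j < t j\<close> or \<open>p j \<le> x\<close>, which has probability \<open>max (t j) x\<close>.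
\<close>
lemma expectation_win:
  assumes i: "i \<in> {1..n}" and t: "\<And>j. j \<in> {1..n} \<Longrightarrow> t j \<in> {0..1}"
  shows "(\<integral>p. win n t i p \<partial>hands n) =
    (\<integral>x. indicator {t i..} x * (\<Prod>j\<in>{1..n} - {i}. max (t j) x) \<partial>unif)"
proof -
  define I where "I = {1..n} - {i}"
  have I: "finite I" "i \<notin> I" "{1..n} = insert i I" using i by (auto simp: I_def)
  have meas: "(\<lambda>p. ennreal (win n t i p)) \<in> borel_measurable (hands n)"
    using integrable_win[OF i] by auto
  have inner: "(\<integral>\<^sup>+ y. ennreal (win n t i (y(i := x))) \<partial>PiM I (\<lambda>_. unif)) =
      ennreal (indicator {t i..} x * (\<Prod>j\<in>I. max (t j) x))" if x: "x \<in> {0..1}" for x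
  proof -
    have "(\<integral>\<^sup>+ y. ennreal (win n t i (y(i := x))) \<partial>PiM I (\<lambda>_. unif)) =
      (\<integral>\<^sup>+ y. indicator {t i..} x * (\<Prod>j\<in>I. indicator ({..<t j} \<union> {..x}) (y j)) \<partial>PiM I (\<lambda>_. unif))"
    proof (rule nn_integral_cong)
      fix y :: "nat \<Rightarrow> real"
      have "(\<Prod>j\<in>I. indicator ({..<t j} \<union> {..x}) ((y(i := x)) j)) = (\<Prod>j\<in>I. indicator ({..<t j} \<union> {..x}) (y j) :: real)"
        by (rule prod.cong) (use I in auto)
      thus "ennreal (win n t i (y(i := x))) = indicator {t i..} x * (\<Prod>j\<in>I. indicator ({..<t j} \<union> {..x}) (y j))"
        by (simp only: win_def fun_upd_same I_def[symmetric])
          (simp add: ennreal_mult' prod_ennreal[symmetric] prod_nonneg flip: ennreal_indicator)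
    qed
    also have "\<dots> = indicator {t i..} x * (\<integral>\<^sup>+ y. (\<Prod>j\<in>I. indicator ({..<t j} \<union> {..x}) (y j)) \<partial>PiM I (\<lambda>_. unif))"
      by (rule nn_integral_cmult) measurable
    also have "(\<integral>\<^sup>+ y. (\<Prod>j\<in>I. indicator ({..<t j} \<union> {..x}) (y j)) \<partial>PiM I (\<lambda>_. unif)) =
        (\<Prod>j\<in>I. \<integral>\<^sup>+ y. indicator ({..<t j} \<union> {..x}) y \<partial>unif)"
      by (rule unifs.product_nn_integral_prod) (use I in auto)
    also have "\<dots> = (\<Prod>j\<in>I. ennreal (max (t j) x))"
    proof (rule prod.cong)
      fix j assume "j \<in> I"
      hence "t j \<in> {0..1}" using t by (auto simp: I_def)
      thus "(\<integral>\<^sup>+ y. indicator ({..<t j} \<union> {..x}) y \<partial>unif) = ennreal (max (t j) x)"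
        using x by (subst nn_integral_indicator) (auto simp: unif.emeasure_eq_measure measure_unif_Iio_Iic simp del: atLeastAtMost_iff)
    qed simp
    also have "indicator {t i..} x * \<dots> = ennreal (indicator {t i..} x * (\<Prod>j\<in>I. max (t j) x))"
      using x by (simp add: ennreal_mult' prod_ennreal ennreal_indicator max.coboundedI2 prod_nonneg)
    finally show ?thesis .
  qed
  have "(\<integral>\<^sup>+ p. ennreal (win n t i p) \<partial>hands n) =
      (\<integral>\<^sup>+ x. (\<integral>\<^sup>+ y. ennreal (win n t i (y(i := x))) \<partial>PiM I (\<lambda>_. unif)) \<partial>unif)"
    using meas unfolding hands_eq I(3)
    by (rule unifs.product_nn_integral_insert_rev[OF I(1,2)])
  also have "\<dots> = (\<integral>\<^sup>+ x. ennreal (indicator {t i..} x * (\<Prod>j\<in>I. max (t j) x)) \<partial>unif)"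
    by (rule nn_integral_cong_AE) (use AE_unif inner in auto)
  finally have eq: "(\<integral>\<^sup>+ p. ennreal (win n t i p) \<partial>hands n) = \<dots>" .
  have nn: "AE x in unif. 0 \<le> indicator {t i..} x * (\<Prod>j\<in>I. max (t j) x)"
    using AE_unif by eventually_elim (auto intro!: prod_nonneg mult_nonneg_nonneg simp: max.coboundedI2)
  show ?thesis
    unfolding I_def[symmetric]
    using integrable_win[OF i] win_eq_01[of n t i]
    by (subst (1 2) integral_eq_nn_integral) (auto simp: eq nn)
qed

lemma alpha_eq:
  assumes i: "i \<in> {1..n}" and t: "\<And>j. j \<in> {1..n} \<Longrightarrow> t j \<in> {0..1}"
  shows "alpha n i t = beta n t - 1 + real n *
    (\<integral>x. indicator {t i..} x * (2 * (\<Prod>j\<in>{1..n} - {i}. max (t j) x) - 1) \<partial>unif)"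
proof -
  have int: "integrable unif (\<lambda>x. indicator {t i..} x * (\<Prod>j\<in>{1..n} - {i}. max (t j) x))"
  proof (rule unif.integrable_const_bound[of _ 1])
    show "AE x in unif. norm (indicator {t i..} x * (\<Prod>j\<in>{1..n} - {i}. max (t j) x)) \<le> 1"
      using AE_unif
    proof eventually_elim
      case (elim x)
      thus ?case using t by (auto simp: indicator_Ici abs_prod intro!: prod_le_1)
    qed
  qed measurable
  have ew: "(\<integral>p. win n t i p \<partial>hands n) =
    (\<integral>x. indicator {t i..} x * (\<Prod>j\<in>{1..n} - {i}. max (t j) x) \<partial>unif)"
    by (rule expectation_win[OF i]) (rule t)
  have ind: "(\<integral>x. indicator {t i..} x \<partial>unif) = 1 - t i"
    using t[OF i] by (simp add: measure_unif_Ici)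
  have "alpha n i t = beta n t - 1 + real n * (2 * (\<integral>p. win n t i p \<partial>hands n) - (1 - t i))"
    unfolding alpha_def beta_def immediate_return_eq[OF i]
    using integrable_win[OF i] integrable_stakes_factor integrable_hands_indicator[OF i] expectation_holds[OF t[OF i] i]
    by (simp add: hands.prob_space)
  also have "2 * (\<integral>p. win n t i p \<partial>hands n) - (1 - t i) =
    (\<integral>x. 2 * (indicator {t i..} x * (\<Prod>j\<in>{1..n} - {i}. max (t j) x)) - indicator {t i..} x \<partial>unif)"
    unfolding ind[symmetric] ew
    by (subst Bochner_Integration.integral_diff)
       (use int in \<open>auto intro: integrable_indicator_unif\<close>)
  finally show ?thesis by (simp add: algebra_simps)
qed

text \<open>
  Without ties the returns sum to zero. Since every tied holder is paid as a winner, a tie can only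
  increase the sum, so the inequality holds for all hands, not just almost surely. It is the direction
  in which a loss of one player yields a joint gain of the others.
\<close>
lemma sum_immediate_return_nonneg: "0 \<le> (\<Sum>i=1..n. immediate_return n t p i)"
proof (cases "holders n t p = {}")
  case True
  thus ?thesis by (simp add: immediate_return_def)
next
  case False
  define H where "H = holders n t p"
  have H: "finite H" "H \<subseteq> {1..n}" "H \<noteq> {}" using False by (auto simp: H_def holders_def)
  have "Max (p ` H) \<in> p ` H" using H by (intro Max_in) auto
  then obtain w where w: "w \<in> H" "p w = Max (p ` H)" by auto
  have max: "p j \<le> p w" if "j \<in> H" for j
    using that H w by auto
  have "0 = (\<Sum>i=1..n. real (card H) - 2) + (\<Sum>i\<in>H. 2 * (if i = w then real n else 0) - real n)"
    using H w by (simp add: sum_subtractf sum_distrib_left[symmetric] algebra_simps)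
  also have "(\<Sum>i\<in>H. 2 * (if i = w then real n else 0) - real n) =
      (\<Sum>i=1..n. if i \<in> H then 2 * (if i = w then real n else 0) - real n else 0)"
    using H by (simp add: sum.If_cases Int_absorb1)
  also have "(\<Sum>i=1..n. real (card H) - 2) + \<dots> \<le> (\<Sum>i=1..n. immediate_return n t p i)"
    unfolding sum.distrib[symmetric]
    by (rule sum_mono) (use w max H in \<open>auto simp: immediate_return_def H_def[symmetric] Let_def\<close>)
  finally show ?thesis .
qed

lemma sum_alpha_nonneg: "0 \<le> (\<Sum>i=1..n. alpha n i s)"
proof -
  have "integrable (hands n) (\<lambda>p. immediate_return n s p i)" if "i \<in> {1..n}" for i
    unfolding immediate_return_eq[OF that]
    by (intro Bochner_Integration.integrable_add Bochner_Integration.integrable_diff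
        integrable_mult_right integrable_stakes_factor integrable_win integrable_hands_indicator that) auto
  hence "(\<Sum>i=1..n. alpha n i s) = (\<integral>p. (\<Sum>i=1..n. immediate_return n s p i) \<partial>hands n)"
    unfolding alpha_def by (subst Bochner_Integration.integral_sum) auto
  also have "\<dots> \<ge> 0" by (intro Bochner_Integration.integral_nonneg sum_immediate_return_nonneg)
  finally show ?thesis .
qed

section \<open>Deviations of a single player\<close>

lemma p_circ_exp: "p_circ n = exp (- ln 2 / (real n - 1))"
  by (simp add: p_circ_def powr_def ln_div)

lemma p_circ_bounds: "2 \<le> n \<Longrightarrow> 0 < p_circ n \<and> p_circ n < 1"
  unfolding p_circ_exp by simp

lemma p_circ_power:
  assumes "2 \<le> n"
  shows "p_circ n ^ (n - 1) = 1/2"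
proof -
  have "p_circ n ^ (n - 1) = p_circ n powr real (n - 1)"
    using p_circ_bounds[OF assms] by (simp add: powr_realpow)
  also have "\<dots> = 1/2"
    unfolding p_circ_def powr_powr using assms by (simp add: of_nat_diff)
  finally show ?thesis .
qed

text \<open>
  The expected stakes factor of the symmetric profile, and also of every profile that differs from it
  in a single player.
\<close>
definition beta_circ :: "nat \<Rightarrow> real" where
  "beta_circ n = (real n - 1) * (1 - p_circ n)"

text \<open>
  The upper bound makes the geometric weights of the rounds summable. With \<open>m = n - 1\<close> it reads
  \<open>m * (1 - exp (- ln 2 / m)) < 1\<close>, which follows from \<open>1 + x \<le> exp x\<close> and \<open>ln 2 < 1\<close>.
\<close>
lemma beta_circ_bounds:
  assumes "2 \<le> n"
  shows "0 < beta_circ n" "beta_circ n < 1"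
proof -
  define m where "m = real n - 1"
  have m: "m \<ge> 1" using assms by (auto simp: m_def)
  have "p_circ n = exp (- ln 2 / m)"
    by (simp add: p_circ_exp m_def)
  moreover have "1 + (- ln 2 / m) \<le> exp (- ln 2 / m)" by (rule exp_ge_add_one_self)
  ultimately have "m * (1 - p_circ n) \<le> m * (ln 2 / m)" using m by (intro mult_left_mono) auto
  also have "\<dots> < 1" using m ln_2_less_1 by simp
  finally show "beta_circ n < 1" by (simp add: beta_circ_def m_def)
  show "0 < beta_circ n" using p_circ_bounds[OF assms] m by (simp add: beta_circ_def m_def)
qed

text \<open>
  Expected outcome of the even-odds unit bet on the highest hand, placed whenever the hand is at least
  \<open>x\<close>, against opponents with threshold \<open>p_circ n\<close>.
\<close>
definition hold_gain :: "nat \<Rightarrow> real \<Rightarrow> real" where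
  "hold_gain n x = (\<integral>y. indicator {x..} y * (2 * max (p_circ n) y ^ (n - 1) - 1) \<partial>unif)"

text \<open>
  The choice of \<open>p_circ\<close> makes the bet exactly fair for hands below \<open>p_circ n\<close>, which win only if all
  opponents drop; higher hands are favourable. So dropping never helps in the bet, and below
  \<open>p_circ n\<close> it makes no difference.
\<close>
lemma hold_gain_integrand_nonneg:
  assumes "2 \<le> n"
  shows "0 \<le> indicator {x..} y * (2 * max (p_circ n) y ^ (n - 1) - 1)"
proof -
  have "p_circ n ^ (n - 1) \<le> max (p_circ n) y ^ (n - 1)"
    using p_circ_bounds[OF assms] by (intro power_mono) auto
  hence "1 / 2 \<le> max (p_circ n) y ^ (n - 1)" unfolding p_circ_power[OF assms] .
  thus ?thesis unfolding indicator_Ici by simp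
qed

lemma integrable_hold_gain:
  assumes "2 \<le> n"
  shows "integrable unif (\<lambda>y. indicator {x..} y * (2 * max (p_circ n) y ^ (n - 1) - 1))"
proof (rule unif.integrable_const_bound[of _ 1])
  show "AE y in unif. norm (indicator {x..} y * (2 * max (p_circ n) y ^ (n - 1) - 1)) \<le> 1"
    using AE_unif
  proof eventually_elim
    case (elim y)
    hence "max (p_circ n) y ^ (n - 1) \<le> 1"
      using p_circ_bounds[OF assms] by (intro power_le_one) auto
    thus ?case
      using hold_gain_integrand_nonneg[OF assms, of x y] by (simp add: indicator_Ici split: if_splits)
  qed
qed measurable

lemma hold_gain_nonneg: "2 \<le> n \<Longrightarrow> 0 \<le> hold_gain n x"
  unfolding hold_gain_def by (intro Bochner_Integration.integral_nonneg hold_gain_integrand_nonneg)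

lemma hold_gain_mono_integrand:
  assumes "2 \<le> n"
  shows "indicator {x..} y * (2 * max (p_circ n) y ^ (n - 1) - 1)
    \<le> indicator {p_circ n..} y * (2 * max (p_circ n) y ^ (n - 1) - 1)"
  using hold_gain_integrand_nonneg[OF assms, of "p_circ n" y] p_circ_power[OF assms]
  by (auto simp: indicator_Ici max_def)

lemma hold_gain_le:
  assumes "2 \<le> n" shows "hold_gain n x \<le> hold_gain n (p_circ n)"
  unfolding hold_gain_def
  using assms by (intro integral_mono integrable_hold_gain hold_gain_mono_integrand)

lemma hold_gain_eq:
  assumes "2 \<le> n" "x \<le> p_circ n" shows "hold_gain n x = hold_gain n (p_circ n)"
  unfolding hold_gain_def
  by (rule Bochner_Integration.integral_cong) (use assms p_circ_power[OF assms(1)] in \<open>auto simp: indicator_Ici max_def\<close>)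

lemma hold_gain_p_circ:
  assumes n: "2 \<le> n"
  shows "real n * hold_gain n (p_circ n) = 1 - beta_circ n"
proof -
  let ?c = "p_circ n"
  have c: "0 < ?c" "?c < 1" using p_circ_bounds[OF n] by auto
  have integrable_power: "integrable lborel (\<lambda>y. y ^ k * indicator {?c..1} y)" for k
    using borel_integrable_compact[of "{?c..1}" "\<lambda>y. y ^ k"]
    by (simp add: continuous_intros mult.commute set_integrable_def)
  have "hold_gain n ?c = (\<integral>y. 2 * (y ^ (n - 1) * indicator {?c..1} y) - y ^ 0 * indicator {?c..1} y \<partial>lborel)"
    unfolding hold_gain_def
    by (subst integral_unif) (use c in \<open>auto simp: indicator_def max_def intro!: Bochner_Integration.integral_cong\<close>)
  also have "\<dots> = 2 * (\<integral>y. y ^ (n - 1) * indicator {?c..1} y \<partial>lborel) - (\<integral>y. y ^ 0 * indicator {?c..1} y \<partial>lborel)"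
    by (subst Bochner_Integration.integral_diff)
       (use integrable_power[of "n - 1"] integrable_power[of 0] in auto)
  also have "\<dots> = 2 * (1 - ?c ^ n) / real n - (1 - ?c)"
    using c n by (subst (1 2) integral_power) auto
  also have "?c ^ n = ?c / 2"
    using p_circ_power[OF n] n by (cases n) auto
  finally show ?thesis using n by (simp add: beta_circ_def field_simps)
qed

lemma prod_others:
  fixes c :: real assumes "i \<in> {1..n}" "\<And>j. j \<in> {1..n} - {i} \<Longrightarrow> f j = c"
  shows "(\<Prod>j\<in>{1..n} - {i}. f j) = c ^ (n - 1)"
  using assms by (simp add: card_Diff_singleton)

context
  fixes n i t
  assumes n: "2 \<le> n" and i: "i \<in> {1..n}"
    and others: "\<And>j. j \<in> {1..n} - {i} \<Longrightarrow> t j = p_circ n" and ti: "t i \<in> {0..1}"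
begin

lemma thresholds_01: "j \<in> {1..n} \<Longrightarrow> t j \<in> {0..1}"
  using others[of j] ti p_circ_bounds[OF n] by (cases "j = i") auto

text \<open>
  Raising one threshold by \<open>d\<close> loses \<open>d\<close> expected holders and adds \<open>2 * d * p_circ n ^ (n - 1) = d\<close>
  through the event that nobody holds, so the deviator has no influence on the stakes.
\<close>
lemma beta_deviation: "beta n t = beta_circ n"
proof -
  have fin: "{1..n} = insert i ({1..n} - {i})" using i by auto
  have "(\<Prod>j=1..n. t j) = t i * (\<Prod>j\<in>{1..n} - {i}. t j)" by (subst fin, subst prod.insert) auto
  also have "(\<Prod>j\<in>{1..n} - {i}. t j) = 1/2"
    using prod_others[OF i others] p_circ_power[OF n] by simp
  finally have P: "(\<Prod>j=1..n. t j) = t i / 2" by simp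
  have "(\<Sum>j=1..n. 1 - t j) = 1 - t i + (\<Sum>j\<in>{1..n} - {i}. 1 - t j)" by (subst fin, subst sum.insert) auto
  also have "(\<Sum>j\<in>{1..n} - {i}. 1 - t j) = (\<Sum>j\<in>{1..n} - {i}. 1 - p_circ n)"
    by (rule sum.cong) (use others in auto)
  also have "\<dots> = beta_circ n" using i n by (simp add: beta_circ_def of_nat_diff)
  finally show ?thesis using P by (subst beta_eq[OF thresholds_01]) auto
qed

lemma alpha_deviation: "alpha n i t = beta_circ n - 1 + real n * hold_gain n (t i)"
proof -
  have "(\<Prod>j\<in>{1..n} - {i}. max (t j) x) = max (p_circ n) x ^ (n - 1)" for x
    by (rule prod_others[OF i]) (use others in auto)
  thus ?thesis
    unfolding hold_gain_def by (subst alpha_eq[OF i thresholds_01]) (simp_all add: beta_deviation)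
qed

lemma alpha_deviation_bounds: "-1 \<le> alpha n i t" "alpha n i t \<le> 0"
  using hold_gain_nonneg[OF n, of "t i"] beta_circ_bounds[OF n] hold_gain_p_circ[OF n]
    mult_left_mono[OF hold_gain_le[OF n, of "t i"], of "real n"]
    mult_nonneg_nonneg[of "real n" "hold_gain n (t i)"]
  by (auto simp: alpha_deviation)

lemma alpha_deviation_eq_0: "t i \<le> p_circ n \<Longrightarrow> alpha n i t = 0"
  using hold_gain_eq[OF n, of "t i"] hold_gain_p_circ[OF n] by (simp add: alpha_deviation)

end

lemma AE_pure: "AE x in pure c. x = c"
  unfolding pure_def by (subst AE_return) auto

text \<open>
  The predicate \<open>P\<close> transports an almost sure property of the deviating strategy to the joint law of
  the thresholds.
\<close>
lemma deviation_AE: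
  fixes c :: real and n i :: nat
  assumes i: "i \<in> {1..n}" and \<mu>: "mixed_strategy \<mu>" and P: "AE x in \<mu>. P x"
  defines "L \<equiv> PiM {1..n} (\<lambda>j. if j = i then \<mu> else pure c)"
  shows "prob_space L" "sets L = sets (PiM {1..n} (\<lambda>_. borel))"
    "AE t in L. (\<forall>j\<in>{1..n} - {i}. t j = c) \<and> t i \<in> {0..1} \<and> P (t i)"
proof -
  let ?M = "\<lambda>j. if j = i then \<mu> else pure c"
  have prob: "prob_space (?M j)" for j
    using \<mu> by (auto simp: mixed_strategy_def pure_def intro: prob_space_return)
  show "prob_space L" unfolding L_def by (rule prob_space_PiM) (rule prob)
  show "sets L = sets (PiM {1..n} (\<lambda>_. borel))"
    unfolding L_def by (rule sets_PiM_cong) (use \<mu> in \<open>auto simp: mixed_strategy_def pure_def\<close>)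
  have "AE t in L. t j = c" if "j \<in> {1..n} - {i}" for j
    unfolding L_def using that prob AE_pure
    by (intro AE_PiM_component) auto
  hence "AE t in L. \<forall>j\<in>{1..n} - {i}. t j = c" by (intro AE_finite_allI) auto
  moreover have "AE x in \<mu>. x \<in> {0..1} \<and> P x" using \<mu> P by (auto simp: mixed_strategy_def)
  hence "AE t in L. t i \<in> {0..1} \<and> P (t i)"
    unfolding L_def using i prob by (intro AE_PiM_component[of _ ?M i "\<lambda>x. x \<in> {0..1} \<and> P x"]) auto
  ultimately show "AE t in L. (\<forall>j\<in>{1..n} - {i}. t j = c) \<and> t i \<in> {0..1} \<and> P (t i)"
    by eventually_elim auto
qed

lemma profile_law_deviation:
  "profile_law n ((circ_profile n)(i := \<tau>)) k =
    PiM {1..n} (\<lambda>j. if j = i then \<tau> k else pure (p_circ n))"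
  unfolding profile_law_def circ_profile_def by (intro PiM_cong) auto

lemma deviation_mixed:
  assumes n: "2 \<le> n" and i: "i \<in> {1..n}" and \<mu>: "mixed_strategy \<mu>"
  defines "L \<equiv> PiM {1..n} (\<lambda>j. if j = i then \<mu> else pure (p_circ n))"
  shows "beta_mixed n L = beta_circ n"
    and "alpha_mixed n i L \<le> 0" "-1 \<le> alpha_mixed n i L"
    and "(AE x in \<mu>. x \<le> p_circ n) \<Longrightarrow> alpha_mixed n i L = 0"
proof -
  interpret L: prob_space L unfolding L_def by (rule deviation_AE(1)[OF i \<mu> AE_I2[of _ "\<lambda>_. True"]]) simp
  have sets_L: "sets L = sets (PiM {1..n} (\<lambda>_. borel))"
    unfolding L_def by (rule deviation_AE(2)[OF i \<mu> AE_I2[of _ "\<lambda>_. True"]]) simp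
  have AE: "AE t in L. (\<forall>j\<in>{1..n} - {i}. t j = p_circ n) \<and> t i \<in> {0..1} \<and> True"
    unfolding L_def by (rule deviation_AE(3)[OF i \<mu>]) simp
  have meas: "alpha n i \<in> borel_measurable L" "beta n \<in> borel_measurable L"
    using measurable_alpha[OF i] measurable_beta[of n] by (simp_all cong: measurable_cong_sets add: sets_L)
  have "AE t in L. beta n t = beta_circ n"
    using AE by eventually_elim (rule beta_deviation[OF n i], auto)
  hence "beta_mixed n L = (\<integral>t. beta_circ n \<partial>L)"
    unfolding beta_mixed_def using meas by (intro integral_cong_AE) auto
  thus "beta_mixed n L = beta_circ n" by (simp add: L.prob_space)
  have bounds: "AE t in L. -1 \<le> alpha n i t \<and> alpha n i t \<le> 0"
    using AE by eventually_elim (intro conjI alpha_deviation_bounds[OF n i], auto)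
  have int: "integrable L (alpha n i)"
    by (rule L.integrable_const_bound[of _ 1]) (use bounds meas in auto)
  show "alpha_mixed n i L \<le> 0" "-1 \<le> alpha_mixed n i L"
    unfolding alpha_mixed_def using bounds int
    by (auto intro!: L.integral_le_const L.integral_ge_const)
  assume "AE x in \<mu>. x \<le> p_circ n"
  from deviation_AE(3)[OF i \<mu> this, of "p_circ n"] have "AE t in L. alpha n i t = 0"
    unfolding L_def[symmetric] by eventually_elim (rule alpha_deviation_eq_0[OF n i], auto)
  thus "alpha_mixed n i L = 0"
    unfolding alpha_mixed_def by (rule integral_eq_zero_AE)
qed

lemma deviation_total_return:
  assumes n: "2 \<le> n" and i: "i \<in> {1..n}" and \<tau>: "\<And>k. mixed_strategy (\<tau> k)"
  shows "\<exists>s\<le>0. has_total_return n (profile_law n ((circ_profile n)(i := \<tau>))) i s"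
    and "(\<And>k. AE x in \<tau> k. x \<le> p_circ n) \<Longrightarrow>
      has_total_return n (profile_law n ((circ_profile n)(i := \<tau>))) i 0"
proof -
  let ?L = "profile_law n ((circ_profile n)(i := \<tau>))"
  let ?b = "beta_circ n"
  let ?a = "\<lambda>k. alpha_mixed n i (?L k)"
  have b: "beta_mixed n (?L k) = ?b" for k
    unfolding profile_law_deviation by (rule deviation_mixed[OF n i \<tau>])
  have a: "?a k \<le> 0" "-1 \<le> ?a k" for k
    unfolding profile_law_deviation by (rule deviation_mixed[OF n i \<tau>])+
  have summable: "summable (\<lambda>k. ?b ^ k * ?a k)"
  proof (rule summable_comparison_test')
    show "summable (\<lambda>k. ?b ^ k)" using beta_circ_bounds[OF n] by (simp add: summable_geometric)
    show "norm (?b ^ k * ?a k) \<le> ?b ^ k" for k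
      using a[of k] beta_circ_bounds[OF n] mult_left_le[of "- ?a k" "?b ^ k"] by (simp add: abs_mult)
  qed
  hence "has_total_return n ?L i (\<Sum>k. ?b ^ k * ?a k)"
    unfolding has_total_return_def by (simp add: b summable_sums)
  moreover have "(\<Sum>k. ?b ^ k * ?a k) \<le> 0"
    using suminf_le[of "\<lambda>k. ?b ^ k * ?a k" "\<lambda>_. 0"] summable a(1) beta_circ_bounds[OF n]
    by (simp add: mult_nonneg_nonpos)
  ultimately show "\<exists>s\<le>0. has_total_return n ?L i s" by blast
  assume le: "\<And>k. AE x in \<tau> k. x \<le> p_circ n"
  have "?a k = 0" for k
    unfolding profile_law_deviation by (rule deviation_mixed(4)[OF n i \<tau> le])
  thus "has_total_return n ?L i 0" by (simp add: has_total_return_def)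
qed

lemma prob_space_pure: "prob_space (pure q)"
  by (simp add: pure_def prob_space_return)

lemma sets_pure: "sets (pure q) = sets borel"
  by (simp add: pure_def)

lemma mixed_strategy_pure: "q \<in> {0..1} \<Longrightarrow> mixed_strategy (pure q)"
  by (simp add: mixed_strategy_def pure_def prob_space_return AE_return)

section \<open>A profitable deviation of players 2 to n\<close>

text \<open>
  Player 3 always holds and player 2 raises the threshold by a small \<open>e\<close>. As it no longer happens
  that nobody holds, the raise is not compensated and the stakes factor drops by exactly \<open>e\<close>, which
  costs player 1 the amount \<open>e\<close>. The raised threshold helps player 1 to win only when the hand of player 1 falls between
  \<open>p_circ n\<close> and \<open>p_circ n + e\<close>, an effect of at most \<open>2 * n * e * e\<close>. The bound \<open>1 / (4 * n)\<close> makes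
  the first-order term win; the bound \<open>1 - p_circ n\<close> keeps the threshold in the unit interval.
\<close>
definition coalition_shift :: "nat \<Rightarrow> real" where
  "coalition_shift n = min (1 - p_circ n) (1 / (4 * real n))"

definition coalition_thresholds :: "nat \<Rightarrow> nat \<Rightarrow> real" where
  "coalition_thresholds n = (\<lambda>_. p_circ n)(2 := p_circ n + coalition_shift n, 3 := 0)"

definition coalition_strategy :: "nat \<Rightarrow> (nat \<Rightarrow> real) measure" where
  "coalition_strategy n = PiM {2..n} (\<lambda>j. pure (coalition_thresholds n j))"

lemma coalition_shift_bounds:
  assumes "2 \<le> n"
  shows "0 < coalition_shift n" "p_circ n + coalition_shift n \<le> 1" "4 * real n * coalition_shift n \<le> 1"
proof -
  show "0 < coalition_shift n" "p_circ n + coalition_shift n \<le> 1"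
    using p_circ_bounds[OF assms] assms by (auto simp: coalition_shift_def)
  have "coalition_shift n \<le> 1 / (4 * real n)" by (simp add: coalition_shift_def)
  thus "4 * real n * coalition_shift n \<le> 1" using assms by (simp add: field_simps)
qed

context
  fixes n :: nat and e :: real and t
  assumes n: "3 \<le> n"
  defines "e \<equiv> coalition_shift n"
  defines "t \<equiv> coalition_thresholds n"
begin

lemma n2: "2 \<le> n" using n by simp

lemma split_players: "{1..n} = insert 1 (insert 2 (insert 3 {4..n}))"
  using n by auto

lemma coalition_thresholds_simps:
  "t 1 = p_circ n" "t 2 = p_circ n + e" "t 3 = 0" "j \<in> {4..n} \<Longrightarrow> t j = p_circ n"
  by (auto simp: t_def e_def coalition_thresholds_def)

lemma coalition_thresholds_01: "t j \<in> {0..1}"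
  using p_circ_bounds[OF n2] coalition_shift_bounds[OF n2]
  by (auto simp: t_def coalition_thresholds_def e_def)

lemma beta_coalition: "beta n t = beta_circ n - e"
proof -
  have "(\<Prod>j=1..n. t j) = 0" using n coalition_thresholds_simps(3) by (intro prod_zero) auto
  moreover have "(\<Sum>j=1..n. 1 - t j) = (1 - t 1) + (1 - t 2) + (1 - t 3) + (\<Sum>j=4..n. 1 - t j)"
    unfolding split_players by simp
  moreover have "(\<Sum>j=4..n. 1 - t j) = (real n - 3) * (1 - p_circ n)"
    using n by (simp add: coalition_thresholds_simps(4) of_nat_diff)
  ultimately show ?thesis
    unfolding beta_eq[OF coalition_thresholds_01] coalition_thresholds_simps(1-3)
    by (simp only: beta_circ_def) (simp add: algebra_simps)
qed

lemma beta_coalition_bounds: "0 \<le> beta n t" "beta n t < 1"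
proof -
  have "e \<le> 1 - p_circ n" using coalition_shift_bounds[OF n2] by (simp add: e_def)
  also have "1 * (1 - p_circ n) \<le> beta_circ n"
    unfolding beta_circ_def using n p_circ_bounds[OF n2] by (intro mult_right_mono) auto
  finally show "0 \<le> beta n t" by (simp add: beta_coalition)
  show "beta n t < 1"
    using beta_circ_bounds[OF n2] coalition_shift_bounds(1)[OF n2] by (simp add: beta_coalition e_def)
qed

text \<open>
  For a hand \<open>x \<ge> p_circ n\<close> of player 1, the winning probability is \<open>x ^ (n - 1)\<close> as before, except
  that one factor \<open>x\<close> is increased to \<open>p_circ n + e\<close>, hence by at most \<open>e\<close>, when \<open>x < p_circ n + e\<close>.
\<close>
lemma alpha_coalition_neg: "alpha n 1 t < 0"
proof -
  let ?c = "p_circ n"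
  have e: "0 < e" "?c + e \<le> 1" "4 * real n * e \<le> 1"
    using coalition_shift_bounds[OF n2] by (auto simp: e_def)
  have c: "0 < ?c" "?c < 1" using p_circ_bounds[OF n2] by auto
  have players: "{1..n} - {1} = insert 2 (insert 3 {4..n})" using n by auto
  have P: "(\<Prod>j\<in>{1..n} - {1}. max (t j) x) = max (?c + e) x * x ^ (n - 2)"
    if x: "?c \<le> x" for x
  proof -
    have "(\<Prod>j=4..n. max (t j) x) = x ^ (n - 3)"
      using x by (simp add: coalition_thresholds_simps(4) max_def)
    hence "(\<Prod>j\<in>{1..n} - {1}. max (t j) x) = max (?c + e) x * (x * x ^ (n - 3))"
      unfolding players using x c by (simp add: coalition_thresholds_simps(2,3) max_def)
    also have "x * x ^ (n - 3) = x ^ (n - 2)"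
    proof -
      have "n - 2 = Suc (n - 3)" using n by simp
      thus ?thesis by simp
    qed
    finally show ?thesis .
  qed
  let ?f = "\<lambda>x. indicator {?c..} x * (2 * (\<Prod>j\<in>{1..n} - {1}. max (t j) x) - 1)"
  let ?g = "\<lambda>x. indicator {?c..} x * (2 * max ?c x ^ (n - 1) - 1)"
  have "integral\<^sup>L unif ?f \<le> (\<integral>x. ?g x + 2 * e * indicator {?c..?c + e} x \<partial>unif)"
  proof (rule integral_mono_AE)
    show "integrable unif ?f"
    proof (rule unif.integrable_const_bound[of _ 1])
      show "AE x in unif. norm (?f x) \<le> 1"
        using AE_unif
      proof eventually_elim
        case (elim x)
        hence "0 \<le> (\<Prod>j\<in>{1..n} - {1}. max (t j) x)" "(\<Prod>j\<in>{1..n} - {1}. max (t j) x) \<le> 1"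
          using coalition_thresholds_01 by (auto intro!: prod_nonneg prod_le_1 simp: max.coboundedI2)
        thus ?case unfolding indicator_Ici by (simp only: real_norm_def) (simp add: abs_le_iff)
      qed
    qed measurable
    show "integrable unif (\<lambda>x. ?g x + 2 * e * indicator {?c..?c + e} x)"
      by (intro Bochner_Integration.integrable_add integrable_hold_gain n2 integrable_mult_right
        integrable_indicator_unif) auto
    show "AE x in unif. ?f x \<le> ?g x + 2 * e * indicator {?c..?c + e} x"
      using AE_unif
    proof eventually_elim
      case (elim x)
      show ?case
      proof (cases "?c \<le> x")
        case True
        have "max (?c + e) x * x ^ (n - 2) \<le> (x + e * indicator {?c..?c + e} x) * x ^ (n - 2)"
          using True e elim by (intro mult_right_mono) (auto simp: indicator_def max_def)
        also have "\<dots> = x ^ (n - 1) + e * indicator {?c..?c + e} x * x ^ (n - 2)"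
        proof -
          have "n - 1 = Suc (n - 2)" using n by simp
          thus ?thesis by (simp add: algebra_simps)
        qed
        also have "e * indicator {?c..?c + e} x * x ^ (n - 2) \<le> e * indicator {?c..?c + e} x"
          using e elim by (intro mult_left_le) (auto intro: power_le_one)
        finally show ?thesis using True P[OF True] by (simp add: max_def)
      next
        case False
        thus ?thesis using e by simp
      qed
    qed
  qed
  also have "\<dots> = hold_gain n ?c + 2 * e * measure unif {?c..?c + e}"
    unfolding hold_gain_def
    by (subst Bochner_Integration.integral_add)
       (use integrable_hold_gain[OF n2, of ?c] in \<open>auto intro!: integrable_mult_right integrable_indicator_unif\<close>)
  also have "measure unif {?c..?c + e} = e"
  proof -
    have "{0..1} \<inter> {?c..?c + e} = {?c..?c + e}" using c e by auto
    thus ?thesis using e by (simp add: measure_unif)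
  qed
  finally have "alpha n 1 t \<le> beta n t - 1 + real n * (hold_gain n ?c + 2 * e * e)"
    using n coalition_thresholds_simps(1)
    by (subst alpha_eq[OF _ coalition_thresholds_01]) (auto intro!: mult_left_mono)
  also have "\<dots> = - e + (4 * real n * e) * e / 2"
    using hold_gain_p_circ[OF n2] by (simp add: beta_coalition algebra_simps)
  also have "\<dots> \<le> - e + 1 * e / 2"
    using e by (intro add_left_mono divide_right_mono mult_right_mono) auto
  also have "\<dots> < 0" using e by simp
  finally show ?thesis .
qed

lemma joint_strategy_coalition: "joint_strategy {2..n} (coalition_strategy n)"
  unfolding joint_strategy_def coalition_strategy_def t_def[symmetric]
proof (intro conjI)
  show "prob_space (PiM {2..n} (\<lambda>j. pure (t j)))" by (intro prob_space_PiM prob_space_pure)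
  show "sets (PiM {2..n} (\<lambda>j. pure (t j))) = sets (PiM {2..n} (\<lambda>_. borel))"
    by (intro sets_PiM_cong sets_pure refl)
  have "AE x in PiM {2..n} (\<lambda>j. pure (t j)). x i \<in> {0..1}" if "i \<in> {2..n}" for i
  proof (rule AE_PiM_component[OF prob_space_pure that])
    show "AE x in pure (t i). x \<in> {0..1}"
      using AE_pure[of "t i"] by eventually_elim (use coalition_thresholds_01 in auto)
  qed
  thus "AE x in PiM {2..n} (\<lambda>j. pure (t j)). \<forall>i\<in>{2..n}. x i \<in> {0..1}"
    by (intro AE_finite_allI) auto
qed

text \<open>
  All strategies are deterministic, so the joint law of the thresholds is a point mass and the mixed
  returns reduce to the values of \<open>alpha\<close> and \<open>beta\<close> at one threshold vector.
\<close>
lemma coalition_law_eq: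
  "coalition_law n (circ_profile n) {2..n} (\<lambda>_. coalition_strategy n) k =
    return (PiM {1..n} (\<lambda>_. borel)) (restrict t {1..n})"
proof -
  interpret product_sigma_finite "\<lambda>j. pure (t j)"
    unfolding product_sigma_finite_def by (intro allI prob_space_imp_sigma_finite prob_space_pure)
  have rest: "{1..n} - {2..n} = {1}" and un: "{2..n} \<union> {1} = {1..n}" using n by auto
  have "PiM {1..n} (\<lambda>j. pure (t j)) =
      distr (PiM {2..n} (\<lambda>j. pure (t j)) \<Otimes>\<^sub>M PiM {1} (\<lambda>j. pure (t j))) (PiM {1..n} (\<lambda>j. pure (t j))) (merge {2..n} {1})"
    using distr_merge[of "{2..n}" "{1}"] unfolding un by simp
  also have "PiM {1} (\<lambda>j. pure (t j)) = PiM {1} (\<lambda>i. circ_profile n i k)"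
    by (intro PiM_cong) (auto simp: circ_profile_def coalition_thresholds_simps(1)[simplified])
  also have "distr (PiM {2..n} (\<lambda>j. pure (t j)) \<Otimes>\<^sub>M \<dots>) (PiM {1..n} (\<lambda>j. pure (t j))) (merge {2..n} {1}) =
      coalition_law n (circ_profile n) {2..n} (\<lambda>_. coalition_strategy n) k"
    unfolding coalition_law_def rest coalition_strategy_def t_def[symmetric]
    by (intro distr_cong sets_PiM_cong sets_pure refl)
  also have "PiM {1..n} (\<lambda>j. pure (t j)) = return (PiM {1..n} (\<lambda>_. borel)) (restrict t {1..n})"
    unfolding pure_def by (rule PiM_return) auto
  finally show ?thesis ..
qed

lemma mixed_coalition_law:
  assumes i: "i \<in> {1..n}"
  defines "L \<equiv> coalition_law n (circ_profile n) {2..n} (\<lambda>_. coalition_strategy n)"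
  shows "alpha_mixed n i (L k) = alpha n i (restrict t {1..n})"
    and "beta_mixed n (L k) = beta n (restrict t {1..n})"
  unfolding L_def coalition_law_eq alpha_mixed_def beta_mixed_def
  by (rule integral_return; use measurable_alpha[OF i] measurable_beta[of n] in \<open>simp add: space_PiM\<close>)+

text \<open>
  The point mass sits at the restriction of \<open>t\<close>, since points of the product space take the default
  value outside the set of players.
\<close>
lemma restrict_thresholds:
  shows "holders n (restrict t {1..n}) = holders n t"
  by (auto simp: holders_def fun_eq_iff)

lemma coalition_total_return:
  assumes i: "i \<in> {1..n}"
  shows "has_total_return n (coalition_law n (circ_profile n) {2..n} (\<lambda>_. coalition_strategy n)) i
    (alpha n i t / (1 - beta n t))"
proof -
  have "alpha n i (restrict t {1..n}) = alpha n i t" "beta n (restrict t {1..n}) = beta n t"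
    unfolding alpha_def beta_def immediate_return_def stakes_factor_def restrict_thresholds by simp_all
  thus ?thesis
    unfolding has_total_return_def mixed_coalition_law[OF i]
    using sums_mult2[OF geometric_sums[of "beta n t"], of "alpha n i t"] beta_coalition_bounds
    by simp
qed

text \<open>
  The stakes factor is the same constant for all players, so every total return is a one-round return
  divided by a common positive number.
\<close>
lemma coalition_gain:
  defines "s \<equiv> \<lambda>i. alpha n i t / (1 - beta n t)"
  shows "s 1 < 0" "(\<Sum>i=2..n. s i) > 0"
proof -
  show "s 1 < 0"
    using alpha_coalition_neg beta_coalition_bounds by (simp add: s_def divide_neg_pos)
  have "{1..n} = insert 1 {2..n}" using n by auto
  hence "0 < (\<Sum>i=2..n. alpha n i t)"
    using sum_alpha_nonneg[of n t] alpha_coalition_neg by simp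
  thus "(\<Sum>i=2..n. s i) > 0"
    using beta_coalition_bounds by (simp add: s_def sum_divide_distrib[symmetric])
qed

end

lemma coalition_deviation:
  assumes "3 \<le> n"
  obtains \<nu> s where "\<And>k. joint_strategy {2..n} (\<nu> k)"
    "\<And>i. i \<in> {1..n} \<Longrightarrow> has_total_return n (coalition_law n (circ_profile n) {2..n} \<nu>) i (s i)"
    "(\<Sum>i\<in>{2..n}. s i) > 0" "s 1 < 0"
  by (rule that[OF joint_strategy_coalition[OF assms] coalition_total_return[OF assms]
        coalition_gain(2)[OF assms] coalition_gain(1)[OF assms]])

section \<open>The equilibrium theorem\<close>

theorem mainTheorem9:
  fixes n :: nat
  assumes "n \<ge> 2"
  shows "nash_equilibrium n (circ_profile n)
    \<and> (\<forall>i\<in>{1..n}. has_total_return n (profile_law n (circ_profile n)) i 0)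
    \<and> (\<forall>i\<in>{1..n}. \<forall>\<tau>. (\<forall>k. mixed_strategy (\<tau> k)) \<longrightarrow>
        (\<exists>s\<le>0. has_total_return n (profile_law n ((circ_profile n)(i := \<tau>))) i s))
    \<and> \<not> strict_nash_equilibrium n (circ_profile n)
    \<and> (\<forall>i\<in>{1..n}. \<exists>\<mu>. mixed_strategy \<mu> \<and> \<mu> \<noteq> pure (p_circ n) \<and>
        (\<exists>s\<ge>0. has_total_return n (profile_law n ((circ_profile n)(i := (\<lambda>_. \<mu>)))) i s))
    \<and> (n \<ge> 3 \<longrightarrow>
        \<not> strong_nash_equilibrium n (circ_profile n) \<and>
        (\<exists>\<nu> s. (\<forall>k. joint_strategy {2..n} (\<nu> k)) \<and>
          (\<forall>i\<in>{1..n}. has_total_return n (coalition_law n (circ_profile n) {2..n} \<nu>) i (s i)) \<and>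
          (\<Sum>i\<in>{2..n}. s i) > 0 \<and> s 1 < 0))"
proof -
  let ?c = "p_circ n"
  have c: "0 < ?c" "?c < 1" using p_circ_bounds[OF assms] by auto
  have zero: "has_total_return n (profile_law n ((circ_profile n)(i := (\<lambda>_. pure q)))) i 0"
    if "i \<in> {1..n}" "0 \<le> q" "q \<le> ?c" for i q
  proof (rule deviation_total_return(2)[OF assms that(1)])
    show "mixed_strategy (pure q)" using that c by (intro mixed_strategy_pure) auto
    show "AE x in pure q. x \<le> ?c" using AE_pure[of q] by eventually_elim (use that in simp)
  qed
  have circ: "has_total_return n (profile_law n (circ_profile n)) i 0" if "i \<in> {1..n}" for i
  proof -
    have "(circ_profile n)(i := (\<lambda>_. pure ?c)) = circ_profile n"
      by (simp add: circ_profile_def fun_eq_iff)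
    thus ?thesis using zero[OF that, of ?c] c by simp
  qed
  have dev: "\<exists>s\<le>0. has_total_return n (profile_law n ((circ_profile n)(i := \<tau>))) i s"
    if "i \<in> {1..n}" "\<forall>k. mixed_strategy (\<tau> k)" for i \<tau>
    using deviation_total_return(1)[OF assms that(1)] that(2) by blast
  have unique: "s = s'" if "has_total_return n L i s" "has_total_return n L i s'" for L i s s'
    using that unfolding has_total_return_def by (rule sums_unique2)
  have nash: "nash_equilibrium n (circ_profile n)"
    unfolding nash_equilibrium_def strategy_profile_def
    using c circ dev unique by (auto simp: circ_profile_def intro!: mixed_strategy_pure) (metis (no_types, lifting))
  \<comment> \<open>Always holding is the deviation that costs nothing.\<close>
  have distinct: "pure 0 \<noteq> pure ?c"
  proof
    assume "pure 0 = pure ?c"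
    hence "measure (pure 0) {0} = measure (pure ?c) {0}" by simp
    thus False using c by (simp add: pure_def measure_return)
  qed
  have not_strict: "\<not> strict_nash_equilibrium n (circ_profile n)"
  proof
    assume "strict_nash_equilibrium n (circ_profile n)"
    moreover have one: "1 \<in> {1..n}" using assms by simp
    ultimately obtain s where s: "has_total_return n (profile_law n (circ_profile n)) 1 s"
      and less: "\<And>\<tau> s'. (\<forall>k. mixed_strategy (\<tau> k)) \<Longrightarrow> \<tau> \<noteq> circ_profile n 1 \<Longrightarrow>
        has_total_return n (profile_law n ((circ_profile n)(1 := \<tau>))) 1 s' \<Longrightarrow> s' < s"
      unfolding strict_nash_equilibrium_def by blast
    have "(\<lambda>_. pure 0) \<noteq> circ_profile n 1" using distinct by (auto simp: circ_profile_def fun_eq_iff)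
    hence "0 < s" using zero[OF one, of 0] c mixed_strategy_pure[of 0] by (intro less) auto
    thus False using unique[OF s circ[OF one]] by simp
  qed
  have not_strong: "\<not> strong_nash_equilibrium n (circ_profile n)" if n3: "3 \<le> n"
  proof
    assume strong: "strong_nash_equilibrium n (circ_profile n)"
    obtain \<nu> s where \<nu>: "\<And>k. joint_strategy {2..n} (\<nu> k)"
      "\<And>i. i \<in> {1..n} \<Longrightarrow> has_total_return n (coalition_law n (circ_profile n) {2..n} \<nu>) i (s i)"
      "(\<Sum>i\<in>{2..n}. s i) > 0"
      using coalition_deviation[OF n3] by metis
    have "(\<Sum>i\<in>{2..n}. s i) \<le> (\<Sum>i\<in>{2..n}. 0)"
      using strong[unfolded strong_nash_equilibrium_def, THEN conjunct2, rule_format, of "{2..n}" \<nu> "\<lambda>_. 0" s]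
        \<nu> circ by auto
    with \<nu>(3) show False by simp
  qed
  have "\<exists>\<nu> s. (\<forall>k. joint_strategy {2..n} (\<nu> k)) \<and>
          (\<forall>i\<in>{1..n}. has_total_return n (coalition_law n (circ_profile n) {2..n} \<nu>) i (s i)) \<and>
          (\<Sum>i\<in>{2..n}. s i) > 0 \<and> s 1 < 0" if "3 \<le> n"
    using coalition_deviation[OF that] by metis
  moreover have "\<exists>\<mu>. mixed_strategy \<mu> \<and> \<mu> \<noteq> pure ?c \<and>
        (\<exists>s\<ge>0. has_total_return n (profile_law n ((circ_profile n)(i := (\<lambda>_. \<mu>)))) i s)"
    if "i \<in> {1..n}" for i
    using zero[OF that, of 0] c mixed_strategy_pure[of 0] distinct
    by (intro exI[of _ "pure 0"]) auto
  ultimately show ?thesis using nash circ dev not_strict not_strong by blast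
qed

end
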